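(* If $(d_1,d_2,d_3,d_4)$ is ripe and $d_1\le d_2\le d_3\le d_4$, then $(d_1,d_2,d_3,d_4)$ is one of $(1,1,1,1)$, $(1,1,1,2)$, $(1,1,2,3)$, $(1,2,3,5)$, $(1,3,4,5)$, $(2,3,5,7)$, $(3,4,5,7)$.
   Context: A quadruple $(d_1,d_2,d_3,d_4)$ of positive integers with $N=\sum_j d_j$ is called ripe if: (i) $\gcd(d_j,N)=1$ for each $j$; (ii) for each $i$, writing $\{i,j,k,\ell\}=\{1,2,3,4\}$, $d_i$ divides one of $d_j+d_k$, $d_j+d_\ell$, $d_k+d_\ell$; (iii) for distinct indices $i\neq j$, if $d_j=d_i$ or $d_j=2d_i$, then $d_i=1$. *)

theory Defs
  imports Main
begin

(* A quadruple (d_1, d_2, d_3, d_4) is represented by a list of length 4, so indices run over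
   0, ..., 3.  In the divisibility condition, the set equation forces i, j, k, l to be
   pairwise distinct. *)

definition ripe :: "nat list \<Rightarrow> bool" where
  "ripe d \<longleftrightarrow>
     length d = 4 \<and> (\<forall>j<4. d ! j > 0) \<and>
     (\<forall>j<4. gcd (d ! j) (\<Sum>i<4. d ! i) = 1) \<and>
     (\<forall>i j k l. {i, j, k, l} = {..<4} \<longrightarrow>
        d ! i dvd d ! j + d ! k \<or> d ! i dvd d ! j + d ! l \<or> d ! i dvd d ! k + d ! l) \<and>
     (\<forall>i<4. \<forall>j<4. i \<noteq> j \<and> (d ! j = d ! i \<or> d ! j = 2 * d ! i) \<longrightarrow> d ! i = 1)"

end

theory Submission
  imports Defs
begin

text \<open>Write the quadruple as \<open>a \<le> b \<le> c \<le> d\<close>. If \<open>d > 1\<close> then \<open>a, b, c < d\<close>, so the divisibility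
  condition at \<open>d\<close> forces \<open>d\<close> to equal a sum of two of \<open>a, b, c\<close>. Substituting this into the
  condition at \<open>c\<close>, and the result into the condition at \<open>b\<close>, each sum reduces modulo its divisor
  to at most three times that divisor, so only finitely many ratios \<open>a : b : c : d\<close> remain.
  Coprimality with the sum and condition (iii) then settle each of them.\<close>

lemma dvd_less_twice_cases:
  fixes n x :: nat
  assumes "n dvd x" "x < 2 * n"
  shows "x = 0 \<or> x = n"
proof -
  obtain q where q: "x = n * q" using assms(1) by (elim dvdE)
  with assms(2) have "q < 2" by (simp add: mult.commute)
  then have "q = 0 \<or> q = 1" by arith
  with q show ?thesis by auto
qed

lemma dvd_le_thrice_cases:
  fixes n x :: nat
  assumes "n dvd x" "x \<le> 3 * n"
  shows "x = 0 \<or> x = n \<or> x = 2 * n \<or> x = 3 * n"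
proof (cases "n = 0")
  case False
  obtain q where q: "x = n * q" using assms(1) by (elim dvdE)
  with assms(2) False have "q \<le> 3" by (simp add: mult.commute)
  then have "q = 0 \<or> q = 1 \<or> q = 2 \<or> q = 3" by arith
  with q show ?thesis by auto
qed (use assms in auto)

lemma ripe_quadrupleD:
  assumes "ripe [a, b, c, d]"
  shows "a > 0" "b > 0" "c > 0" "d > 0"
    and "gcd a (a + b + c + d) = 1"
    and "b dvd a + c \<or> b dvd a + d \<or> b dvd c + d"
    and "c dvd a + b \<or> c dvd a + d \<or> c dvd b + d"
    and "d dvd a + b \<or> d dvd a + c \<or> d dvd b + c"
    and "b = a \<or> b = 2 * a \<Longrightarrow> a = 1"
    and "c = a \<or> c = 2 * a \<Longrightarrow> a = 1"
    and "c = b \<or> c = 2 * b \<Longrightarrow> b = 1"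
    and "d = c \<Longrightarrow> c = 1"
    and "gcd b (a + b + c + d) = 1"
proof -
  let ?l = "[a, b, c, d]"
  have all4: "(\<forall>i<4. P i) \<longleftrightarrow> P 0 \<and> P 1 \<and> P 2 \<and> P 3" for P :: "nat \<Rightarrow> bool"
    by (auto simp: numeral_eq_Suc less_Suc_eq)
  have pos: "\<forall>j<4. ?l ! j > 0" and cop: "\<forall>j<4. gcd (?l ! j) (\<Sum>i<4. ?l ! i) = 1"
    and div: "\<And>i j k l. {i, j, k, l} = {..<4} \<Longrightarrow>
        ?l ! i dvd ?l ! j + ?l ! k \<or> ?l ! i dvd ?l ! j + ?l ! l \<or> ?l ! i dvd ?l ! k + ?l ! l"
    and dist: "\<And>i j. i < 4 \<Longrightarrow> j < 4 \<Longrightarrow> i \<noteq> j \<Longrightarrow>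
        ?l ! j = ?l ! i \<or> ?l ! j = 2 * ?l ! i \<Longrightarrow> ?l ! i = 1"
    using assms unfolding ripe_def by blast+
  show "a > 0" "b > 0" "c > 0" "d > 0"
    using pos by (auto simp: all4)
  have "(\<Sum>i<4. ?l ! i) = a + b + c + d"
    by (simp add: numeral_eq_Suc)
  then show "gcd a (a + b + c + d) = 1" "gcd b (a + b + c + d) = 1"
    using cop by (auto simp: all4)
  \<comment> \<open>The leading index of each enumeration is that of the divisor: \<open>b\<close>,
    \<open>c\<close> and \<open>d\<close> in turn.\<close>
  have "{1, 0, 2, 3} = {..<4::nat}" "{2, 0, 1, 3} = {..<4::nat}" "{3, 0, 1, 2} = {..<4::nat}"
    by auto
  from this[THEN div]
  show "b dvd a + c \<or> b dvd a + d \<or> b dvd c + d"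
    and "c dvd a + b \<or> c dvd a + d \<or> c dvd b + d"
    and "d dvd a + b \<or> d dvd a + c \<or> d dvd b + c"
    by simp_all
  show "b = a \<or> b = 2 * a \<Longrightarrow> a = 1" using dist[of 0 1] by simp
  show "c = a \<or> c = 2 * a \<Longrightarrow> a = 1" using dist[of 0 2] by simp
  show "c = b \<or> c = 2 * b \<Longrightarrow> b = 1" using dist[of 1 2] by simp
  show "d = c \<Longrightarrow> c = 1" using dist[of 2 3] by simp
qed

theorem theorem12:
  fixes d1 d2 d3 d4 :: nat
  assumes "ripe [d1, d2, d3, d4]"
    and "d1 \<le> d2" and "d2 \<le> d3" and "d3 \<le> d4"
  shows "(d1, d2, d3, d4) \<in>
    {(1, 1, 1, 1), (1, 1, 1, 2), (1, 1, 2, 3), (1, 2, 3, 5),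
     (1, 3, 4, 5), (2, 3, 5, 7), (3, 4, 5, 7)}"
proof -
  note ripe = ripe_quadrupleD[OF assms(1)]
  note pos = ripe(1-4) and b_dvd = ripe(6) and c_dvd = ripe(7) and d_dvd = ripe(8)
    and ab = ripe(9) and ac = ripe(10) and bc = ripe(11) and cd = ripe(12)
  note ord = assms(2-4)
  \<comment> \<open>Fixes the scale once the ratio of the entries is known: a common factor also
    divides the total, which is coprime to \<open>d1\<close>.\<close>
  have scale: "k = 1" if "k dvd d1" "k dvd d2" "k dvd d3" "k dvd d4" for k
  proof -
    have "k dvd gcd d1 (d1 + d2 + d3 + d4)" using that by simp
    then show ?thesis using ripe(5) by simp
  qed
  show ?thesis
  proof (cases "d3 = 1")
    case True
    then have "d1 = 1" "d2 = 1" using pos ord by auto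
    moreover from this True have "d4 dvd 2" using d_dvd by (simp add: numeral_2_eq_2)
    then have "d4 \<le> 2" by (rule dvd_imp_le) simp
    then have "d4 = 1 \<or> d4 = 2" using pos by arith
    ultimately show ?thesis using True by auto
  next
    case False
    \<comment> \<open>By (iii), equality in either place would make the entries concerned 1, against
      \<open>d3 \<noteq> 1\<close>.\<close>
    then have lt: "d2 < d3" "d3 < d4"
      using bc cd ord by fastforce+
    have "d4 = d1 + d2 \<or> d4 = d1 + d3 \<or> d4 = d2 + d3"
      using d_dvd lt ord pos by (elim disjE) (drule dvd_less_twice_cases; arith)+
    then consider (d_bc) "d4 = d2 + d3" | (d_ac) "d4 = d1 + d3" | (d_ab) "d4 = d1 + d2"
      by blast
    then show ?thesis
    proof cases
      case d: d_bc
      have "d3 dvd d1 + d2 \<or> d3 dvd 2 * d2"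
      proof -
        have "d1 + d4 = d1 + d2 + d3" "d2 + d4 = 2 * d2 + d3" using d by simp_all
        with c_dvd show ?thesis by (metis dvd_add_left_iff dvd_refl)
      qed
      then have "d3 = d1 + d2 \<or> d3 = 2 * d2"
        using lt ord pos by (elim disjE) (drule dvd_less_twice_cases; arith)+
      then show ?thesis
      proof
        assume c: "d3 = d1 + d2"
        \<comment> \<open>Modulo \<open>d2\<close> all three sums reduce to \<open>2 * d1\<close>,
          which is positive and at most \<open>2 * d2\<close>.\<close>
        have "d2 dvd d1 + (d1 + d2) \<or> d2 dvd d1 + (d2 + (d1 + d2)) \<or> d2 dvd d1 + d2 + (d2 + (d1 + d2))"
          using b_dvd unfolding d c .
        moreover have "d1 + (d1 + d2) = 2 * d1 + d2" "d1 + (d2 + (d1 + d2)) = 2 * d1 + d2 * 2"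
          "d1 + d2 + (d2 + (d1 + d2)) = 2 * d1 + d2 * 3" by simp_all
        ultimately have "d2 dvd 2 * d1"
          by (metis dvd_add_left_iff dvd_refl dvd_triv_left)
        then have "2 * d1 = d2 \<or> d1 = d2"
          using ord pos by - (drule dvd_le_thrice_cases; arith)
        moreover from this have "d1 = 1" using ab by metis
        ultimately show ?thesis using c d by auto
      next
        assume c: "d3 = 2 * d2"
        then have "d2 = 1" using bc by blast
        then show ?thesis using c d ord pos by auto
      qed
    next
      case d: d_ac
      have "d3 dvd d1 + d2 \<or> d3 dvd 2 * d1"
      proof -
        have "d1 + d4 = 2 * d1 + d3" "d2 + d4 = d1 + d2 + d3" using d by simp_all
        with c_dvd show ?thesis by (metis dvd_add_left_iff dvd_refl)
      qed
      then have "d3 = d1 + d2 \<or> d3 = 2 * d1"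
        using lt ord pos by (elim disjE) (drule dvd_less_twice_cases; arith)+
      then show ?thesis
      proof
        assume c: "d3 = d1 + d2"
        \<comment> \<open>Modulo \<open>d2\<close> the sums reduce to \<open>2 * d1\<close>,
          \<open>3 * d1\<close> and \<open>3 * d1\<close>.\<close>
        have "d2 dvd d1 + (d1 + d2) \<or> d2 dvd d1 + (d1 + (d1 + d2)) \<or> d2 dvd d1 + d2 + (d1 + (d1 + d2))"
          using b_dvd unfolding d c .
        moreover have "d1 + (d1 + d2) = 2 * d1 + d2" "d1 + (d1 + (d1 + d2)) = 3 * d1 + d2"
          "d1 + d2 + (d1 + (d1 + d2)) = 3 * d1 + d2 * 2" by simp_all
        ultimately have "d2 dvd 2 * d1 \<or> d2 dvd 3 * d1"
          by (metis dvd_add_left_iff dvd_refl dvd_triv_left)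
        then have "2 * d1 = d2 \<or> d1 = d2 \<or> 3 * d1 = d2 \<or> 3 * d1 = 2 * d2"
          using ord pos by (elim disjE) (drule dvd_le_thrice_cases; arith)+
        then consider "2 * d1 = d2" | "d1 = d2" | "3 * d1 = d2" | "3 * d1 = 2 * d2" by blast
        then show ?thesis
        proof cases
          case 1
          moreover from this have "d1 = 1" using ab by metis
          ultimately have "d1 = 1" "d2 = 2" "d3 = 3" "d4 = 4" using c d by auto
          \<comment> \<open>The candidate (1,2,3,4) has total 10, so coprimality fails at its entry
            2.\<close>
          then have "gcd 2 (10::nat) = 1" using ripe(13) by simp
          moreover have "2 dvd gcd 2 (10::nat)" by (intro gcd_greatest) simp_all
          ultimately show ?thesis by simp
        next
          case 2
          moreover from this have "d1 = 1" using ab by metis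
          ultimately show ?thesis using c d by auto
        next
          case 3
          then have "d1 = 1" using c d by (intro scale) auto
          then show ?thesis using 3 c d by auto
        next
          case 4
          \<comment> \<open>The ratio is 2 : 3 : 5 : 7; parity provides the common factor
            \<open>k\<close>.\<close>
          then have "even d1" by presburger
          then obtain k where k: "d1 = 2 * k" by (elim evenE)
          then have eqs: "d2 = 3 * k" "d3 = 5 * k" "d4 = 7 * k" using 4 c d by auto
          then have "k = 1" using k by (intro scale) auto
          then show ?thesis using k eqs by auto
        qed
      next
        assume c: "d3 = 2 * d1"
        then have "d1 = 1" using ac by blast
        then show ?thesis using c d lt pos by auto
      qed
    next
      case d: d_ab
      have "d3 dvd d1 + d2 \<or> d3 dvd 2 * d1 + d2 \<or> d3 dvd d1 + 2 * d2"
      proof -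
        have "d1 + d4 = 2 * d1 + d2" "d2 + d4 = d1 + 2 * d2" using d by simp_all
        with c_dvd show ?thesis by metis
      qed
      \<comment> \<open>Since \<open>d1 + d2 = d4\<close> lies strictly between \<open>d3\<close>
        and \<open>2 * d3\<close>, the first alternative fails. The other two sums lie strictly
        between \<open>d3\<close> and \<open>3 * d3\<close>, hence equal
        \<open>2 * d3\<close>.\<close>
      then have "2 * d3 = 2 * d1 + d2 \<or> 2 * d3 = d1 + 2 * d2"
        using lt ord pos d by (elim disjE) (drule dvd_le_thrice_cases; arith)+
      then show ?thesis
      proof
        assume c: "2 * d3 = 2 * d1 + d2"
        then have "even d2" by presburger
        then obtain m where b: "d2 = 2 * m" by (elim evenE)
        have c: "d3 = d1 + m" and d: "d4 = d1 + 2 * m" using b c d by auto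
        \<comment> \<open>Modulo \<open>d2 = 2 * m\<close> the sums reduce to
          \<open>2 * d1 + m\<close> or \<open>2 * d1\<close>. The solution \<open>2 * d1 = m\<close>
          is excluded because \<open>d2 < d3\<close> means \<open>m < d1\<close>.\<close>
        have "2 * m dvd d1 + (d1 + m) \<or> 2 * m dvd d1 + (d1 + 2 * m) \<or>
            2 * m dvd d1 + m + (d1 + 2 * m)"
          using b_dvd unfolding b c d .
        moreover have "d1 + (d1 + m) = 2 * d1 + m" "d1 + (d1 + 2 * m) = 2 * d1 + 2 * m"
          "d1 + m + (d1 + 2 * m) = 2 * d1 + m + 2 * m" by simp_all
        ultimately have "2 * m dvd 2 * d1 + m \<or> 2 * m dvd 2 * d1"
          by (metis dvd_add_left_iff dvd_refl)
        then have "2 * d1 = 3 * m \<or> d1 = m \<or> d1 = 2 * m"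
          using ord pos lt b c by (elim disjE) (drule dvd_le_thrice_cases; arith)+
        then show ?thesis
        proof (elim disjE)
          assume *: "2 * d1 = 3 * m"
          then have "even m" by presburger
          then obtain k where k: "m = 2 * k" by (elim evenE)
          then have eqs: "d1 = 3 * k" "d2 = 4 * k" "d3 = 5 * k" "d4 = 7 * k" using * b c d by auto
          then have "k = 1" by (intro scale) auto
          then show ?thesis using eqs by auto
        next
          \<comment> \<open>Here \<open>d2 = 2 * d1\<close>, so (iii) gives \<open>d1 = 1\<close>
            and then \<open>d2 = d3 = 2\<close>, against \<open>d2 < d3\<close>.\<close>
          assume *: "d1 = m"
          then have "d1 = 1" using ab b by metis
          then show ?thesis using * b c lt by auto
        next
          \<comment> \<open>Here \<open>d1 = d2\<close>, so (iii) makes the even number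
            \<open>d1\<close> equal to 1.\<close>
          assume *: "d1 = 2 * m"
          then have "d1 = 1" using ab b by metis
          then show ?thesis using * by auto
        qed
      next
        assume c: "2 * d3 = d1 + 2 * d2"
        then have "even d1" by presburger
        then obtain m where a: "d1 = 2 * m" by (elim evenE)
        have c: "d3 = d2 + m" and d: "d4 = d2 + 2 * m" using a c d by auto
        have "d2 dvd 2 * m + (d2 + m) \<or> d2 dvd 2 * m + (d2 + 2 * m) \<or> d2 dvd d2 + m + (d2 + 2 * m)"
          using b_dvd unfolding a c d .
        moreover have "2 * m + (d2 + m) = 3 * m + d2" "2 * m + (d2 + 2 * m) = 4 * m + d2"
          "d2 + m + (d2 + 2 * m) = 3 * m + d2 * 2" by simp_all
        ultimately have "d2 dvd 3 * m \<or> d2 dvd 4 * m"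
          by (metis dvd_add_left_iff dvd_refl dvd_triv_left)
        then have "d2 = 3 * m \<or> d2 = 2 * d1 \<or> d2 = d1"
          using a ord pos by (elim disjE) (drule dvd_le_thrice_cases; arith)+
        \<comment> \<open>This branch is empty: as \<open>d1\<close> is even, (iii) rules out
          \<open>d2 = d1\<close> and \<open>d2 = 2 * d1\<close>, while \<open>d2 = 3 * m\<close>
          would give \<open>d3 = 4 * m = 2 * d1\<close>, also ruled out.\<close>
        moreover have "d1 \<noteq> 1" using a by presburger
        then have "d2 \<noteq> 2 * d1" "d2 \<noteq> d1" "d3 \<noteq> 2 * d1" using ab ac by blast+
        ultimately show ?thesis using a c by auto
      qed
    qed
  qed
qed

end
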